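(* Let $(\mathcal S,U,P)$ be a BCL triple with associated BCL pair $(M_{\phi_1},M_{\phi_2})$ on $H^2_{\mathcal S}(\mathbb T)$. Then $H(M_{\phi_1},M_{\phi_2})=0$ if and only if $PUP=0$ and $U^2PU^{*2}=P$.
   Context: A BCL triple $(\mathcal S,U,P)$ consists of a complex separable Hilbert space $\mathcal S$, a unitary $U$ on $\mathcal S$ and an orthogonal projection $P$ on $\mathcal S$; $P^\perp=I-P$. $H^2(\mathbb T)$ is the Hardy space of the circle, $S_z$ is multiplication by $z$ on it, and $H^2_{\mathcal S}(\mathbb T)$ ($\mathcal S$-valued Hardy space) is identified with $H^2(\mathbb T)\otimes\mathcal S$. The BCL pair is the commuting pair of isometries $M_{\phi_1}=I\otimes PU^*+S_z\otimes P^\perp U^*$, $M_{\phi_2}=I\otimes UP^\perp+S_z\otimes UP$. For commuting isometries $(V_1,V_2)$, $H(V_1,V_2):=V_2V_2^*-V_1V_1^*-V_2^2V_2^{*2}+V_1V_2V_1^*V_2^*$. *)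

theory Defs
  imports "HOL-Analysis.Analysis"
begin

text \<open>Positivity and definiteness of \<open>cinner\<close>, and the fact that it induces the norm, are
  inherited from \<open>real_inner\<close> through \<open>Re_cinner\<close>.\<close>

class complex_inner = real_inner +
  fixes scaleC :: "complex \<Rightarrow> 'a \<Rightarrow> 'a"  (infixr "*\<^sub>C" 75)
    and cinner :: "'a \<Rightarrow> 'a \<Rightarrow> complex"
  assumes scaleC_add_right: "c *\<^sub>C (x + y) = c *\<^sub>C x + c *\<^sub>C y"
    and scaleC_add_left: "(c + d) *\<^sub>C x = c *\<^sub>C x + d *\<^sub>C x"
    and scaleC_scaleC: "c *\<^sub>C (d *\<^sub>C x) = (c * d) *\<^sub>C x"
    and scaleC_of_real: "complex_of_real r *\<^sub>C x = r *\<^sub>R x"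
    and cinner_add_left: "cinner (x + y) z = cinner x z + cinner y z"
    and cinner_scaleC_left: "cinner (c *\<^sub>C x) y = c * cinner x y"
    and cinner_commute: "cinner x y = cnj (cinner y x)"
    and Re_cinner: "Re (cinner x y) = inner x y"

class complex_hilbert = complex_inner + complete_space

subclass (in complex_hilbert) banach ..

instantiation complex :: complex_hilbert
begin

definition scaleC_complex :: "complex \<Rightarrow> complex \<Rightarrow> complex"
  where "scaleC_complex c x = c * x"

definition cinner_complex :: "complex \<Rightarrow> complex \<Rightarrow> complex"
  where "cinner_complex x y = x * cnj y"

instance
  by standard
    (auto simp: scaleC_complex_def cinner_complex_def algebra_simps scaleR_conv_of_real
      inner_complex_def)

end

lemma scaleC_one [simp]: "1 *\<^sub>C x = (x :: 'a::complex_inner)"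
  using scaleC_of_real[of 1 x] by simp

lemma cinner_scaleC_right:
  fixes x :: "'a::complex_inner"
  shows "cinner x (c *\<^sub>C y) = cnj c * cinner x y"
  by (metis cinner_commute cinner_scaleC_left complex_cnj_mult)

lemma cinner_add_right:
  fixes x :: "'a::complex_inner"
  shows "cinner x (y + z) = cinner x y + cinner x z"
  by (metis cinner_commute cinner_add_left complex_cnj_add)

lemma cinner_self:
  fixes x :: "'a::complex_inner"
  shows "cinner x x = complex_of_real ((norm x)\<^sup>2)"
proof (rule complex_eqI)
  show "Re (cinner x x) = Re (complex_of_real ((norm x)\<^sup>2))"
    by (simp add: Re_cinner power2_norm_eq_inner)
  have "Im (cinner x x) = Im (cnj (cinner x x))"
    using cinner_commute[of x x] by metis
  then show "Im (cinner x x) = Im (complex_of_real ((norm x)\<^sup>2))" by simp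
qed

lemma norm_scaleC:
  fixes x :: "'a::complex_inner"
  shows "norm (c *\<^sub>C x) = cmod c * norm x"
proof -
  have "complex_of_real ((norm (c *\<^sub>C x))\<^sup>2) = (c * cnj c) * complex_of_real ((norm x)\<^sup>2)"
    unfolding cinner_self[symmetric] by (simp add: cinner_scaleC_left cinner_scaleC_right)
  also have "\<dots> = complex_of_real ((cmod c * norm x)\<^sup>2)"
    by (simp only: complex_norm_square[symmetric] of_real_mult[symmetric] power_mult_distrib)
  finally have "(norm (c *\<^sub>C x))\<^sup>2 = (cmod c * norm x)\<^sup>2"
    by (simp only: of_real_eq_iff)
  then show ?thesis
    by (simp add: power2_eq_iff_nonneg)
qed

lemma norm_cinner_le:
  fixes x :: "'a::complex_inner"
  shows "cmod (cinner x y) \<le> 2 * (norm x * norm y)"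
proof -
  have "Im (cinner x y) = Re (cinner ((- \<i>) *\<^sub>C x) y)"
    by (simp add: cinner_scaleC_left)
  then have "Im (cinner x y) = inner ((- \<i>) *\<^sub>C x) y"
    by (simp add: Re_cinner)
  then have "\<bar>Im (cinner x y)\<bar> \<le> norm ((- \<i>) *\<^sub>C x) * norm y"
    using Cauchy_Schwarz_ineq2[of "(- \<i>) *\<^sub>C x" y] by simp
  moreover have "\<bar>Re (cinner x y)\<bar> \<le> norm x * norm y"
    unfolding Re_cinner by (rule Cauchy_Schwarz_ineq2)
  ultimately show ?thesis
    using cmod_le[of "cinner x y"] by (simp add: norm_scaleC)
qed

lemma bounded_bilinear_scaleC:
  "bounded_bilinear (scaleC :: complex \<Rightarrow> 'a::complex_inner \<Rightarrow> 'a)"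
proof
  fix a a' :: complex and b b' :: 'a and r :: real
  show "(a + a') *\<^sub>C b = a *\<^sub>C b + a' *\<^sub>C b" by (rule scaleC_add_left)
  show "a *\<^sub>C (b + b') = a *\<^sub>C b + a *\<^sub>C b'" by (rule scaleC_add_right)
  show "(r *\<^sub>R a) *\<^sub>C b = r *\<^sub>R (a *\<^sub>C b)"
    using scaleC_scaleC[of "complex_of_real r" a b] by (simp add: scaleC_of_real scaleR_conv_of_real)
  show "a *\<^sub>C (r *\<^sub>R b) = r *\<^sub>R (a *\<^sub>C b)"
    by (simp add: scaleC_of_real[symmetric] scaleC_scaleC mult.commute)
  show "\<exists>K. \<forall>a (b::'a). norm (a *\<^sub>C b) \<le> norm a * norm b * K"
    by (rule exI[of _ 1]) (simp add: norm_scaleC)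
qed

lemma bounded_bilinear_cinner:
  "bounded_bilinear (cinner :: 'a::complex_inner \<Rightarrow> 'a \<Rightarrow> complex)"
proof
  fix a a' b b' :: 'a and r :: real
  show "cinner (a + a') b = cinner a b + cinner a' b" by (rule cinner_add_left)
  show "cinner a (b + b') = cinner a b + cinner a b'" by (rule cinner_add_right)
  show "cinner (r *\<^sub>R a) b = r *\<^sub>R cinner a b"
    using cinner_scaleC_left[of "complex_of_real r" a b] by (simp add: scaleC_of_real scaleR_conv_of_real)
  show "cinner a (r *\<^sub>R b) = r *\<^sub>R cinner a b"
    using cinner_scaleC_right[of a "complex_of_real r" b] by (simp add: scaleC_of_real scaleR_conv_of_real)
  show "\<exists>K. \<forall>(a::'a) b. norm (cinner a b) \<le> norm a * norm b * K"
    using norm_cinner_le by (metis mult.commute)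
qed

lemma scaleC_zero_right [simp]: "c *\<^sub>C 0 = (0 :: 'a::complex_inner)"
  by (rule bounded_bilinear.zero_right[OF bounded_bilinear_scaleC])

definition bounded_clinear :: "('a::complex_inner \<Rightarrow> 'b::complex_inner) \<Rightarrow> bool"
  where "bounded_clinear T \<longleftrightarrow> bounded_linear T \<and> (\<forall>c x. T (c *\<^sub>C x) = c *\<^sub>C T x)"

definition is_cadjoint :: "('a::complex_inner \<Rightarrow> 'b::complex_inner) \<Rightarrow> ('b \<Rightarrow> 'a) \<Rightarrow> bool"
  where "is_cadjoint T T' \<longleftrightarrow> (\<forall>x y. cinner (T x) y = cinner x (T' y))"

lemma is_cadjoint_unique:
  assumes "is_cadjoint T T1" "is_cadjoint T T2"
  shows "T1 = T2"
proof
  fix y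
  let ?d = "T1 y - T2 y"
  have eq: "cinner x (T1 y) = cinner x (T2 y)" for x
    using assms unfolding is_cadjoint_def by metis
  have "inner ?d (T1 y) = inner ?d (T2 y)"
    using eq[of ?d] by (metis Re_cinner)
  then have "inner ?d ?d = 0" by (simp only: inner_diff_right)
  then show "T1 y = T2 y" by simp
qed

text \<open>On non-complete spaces the adjoint need not exist; \<open>cadjoint_eq\<close> reduces its computation to
  exhibiting one.\<close>

definition cadjoint :: "('a::complex_inner \<Rightarrow> 'b::complex_inner) \<Rightarrow> 'b \<Rightarrow> 'a"
  where "cadjoint T = (THE T'. is_cadjoint T T')"

lemma cadjoint_eq: "is_cadjoint T T' \<Longrightarrow> cadjoint T = T'"
  unfolding cadjoint_def by (rule the_equality) (auto intro: is_cadjoint_unique)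

definition unitary_op :: "('a::complex_inner \<Rightarrow> 'a) \<Rightarrow> bool"
  where "unitary_op U \<longleftrightarrow>
    bounded_clinear U \<and> surj U \<and> (\<forall>x y. cinner (U x) (U y) = cinner x y)"

definition orth_projection :: "('a::complex_inner \<Rightarrow> 'a) \<Rightarrow> bool"
  where "orth_projection P \<longleftrightarrow> bounded_clinear P \<and> P \<circ> P = P \<and> is_cadjoint P P"

definition compl_proj :: "('a::complex_inner \<Rightarrow> 'a) \<Rightarrow> 'a \<Rightarrow> 'a"
  where "compl_proj P = (\<lambda>x. x - P x)"

text \<open>Normalised arc length measure, as a Borel measure on the plane concentrated on the unit
  circle.\<close>

definition circle_measure :: "complex measure"
  where "circle_measure = distr (uniform_measure lborel {0..2 * pi}) borel cis"

text \<open>On the unit circle \<open>z powi (- n)\<close> is the conjugate of \<open>z powi n\<close>.\<close>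

definition fourier_coeff :: "(complex \<Rightarrow> 'a::{complex_hilbert, second_countable_topology}) \<Rightarrow> int \<Rightarrow> 'a"
  where "fourier_coeff f n = (LINT z|circle_measure. (z powi (- n)) *\<^sub>C f z)"

definition square_integrable :: "(complex \<Rightarrow> 'a::{complex_hilbert, second_countable_topology}) \<Rightarrow> bool"
  where "square_integrable f \<longleftrightarrow>
    f \<in> borel_measurable circle_measure \<and> integrable circle_measure (\<lambda>z. (norm (f z))\<^sup>2)"

definition hardy_fun :: "(complex \<Rightarrow> 'a::{complex_hilbert, second_countable_topology}) \<Rightarrow> bool"
  where "hardy_fun f \<longleftrightarrow> square_integrable f \<and> (\<forall>n<0. fourier_coeff f n = 0)"

definition hardy_rel :: "(complex \<Rightarrow> 'a::{complex_hilbert, second_countable_topology})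
    \<Rightarrow> (complex \<Rightarrow> 'a) \<Rightarrow> bool"
  where "hardy_rel f g \<longleftrightarrow> hardy_fun f \<and> hardy_fun g \<and> (AE z in circle_measure. f z = g z)"

lemma cis_measurable: "cis \<in> borel_measurable (uniform_measure lborel {0..2 * pi})"
proof -
  have "cis \<in> borel_measurable borel"
    by (intro borel_measurable_continuous_onI continuous_intros)
  then show ?thesis
    by (simp cong: measurable_cong_sets)
qed

lemma sets_circle_measure [measurable_cong, simp]: "sets circle_measure = sets borel"
  by (simp add: circle_measure_def)

lemma space_circle_measure [simp]: "space circle_measure = UNIV"
  by (simp add: circle_measure_def)

lemma emeasure_circle_measure_UNIV: "emeasure circle_measure UNIV = 1"
proof -
  note cis_measurable [measurable]
  show ?thesis
    unfolding circle_measure_def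
    by (subst emeasure_distr)
      (auto simp: emeasure_uniform_measure ennreal_divide_self ennreal_mult_eq_top_iff)
qed

interpretation circle: finite_measure circle_measure
  by standard (simp add: emeasure_circle_measure_UNIV)

lemma AE_circle_norm: "AE z in circle_measure. norm z = 1"
proof -
  note cis_measurable [measurable]
  show ?thesis
    unfolding circle_measure_def by (subst AE_distr_iff) auto
qed

lemma integrable_bound_sq:
  fixes h :: "complex \<Rightarrow> 'b::{banach, second_countable_topology}"
  assumes "square_integrable f" "square_integrable g"
    and "h \<in> borel_measurable circle_measure"
    and "AE z in circle_measure. norm (h z) \<le> C * ((norm (f z))\<^sup>2 + (norm (g z))\<^sup>2) + D"
  shows "integrable circle_measure h"
proof (rule Bochner_Integration.integrable_bound)
  show "integrable circle_measure (\<lambda>z. C * ((norm (f z))\<^sup>2 + (norm (g z))\<^sup>2) + D)"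
    using assms(1,2) unfolding square_integrable_def by auto
  show "AE z in circle_measure. norm (h z) \<le> norm (C * ((norm (f z))\<^sup>2 + (norm (g z))\<^sup>2) + D)"
    using assms(4) by eventually_elim auto
qed (fact assms)

lemma scaleC_measurable [measurable (raw)]:
  fixes f :: "'m \<Rightarrow> 'a::{complex_hilbert, second_countable_topology}"
  assumes "a \<in> borel_measurable M" "f \<in> borel_measurable M"
  shows "(\<lambda>z. a z *\<^sub>C f z) \<in> borel_measurable M"
  by (rule borel_measurable_continuous_Pair[OF assms])
    (intro bounded_bilinear.continuous_on[OF bounded_bilinear_scaleC] continuous_intros)

lemma cinner_measurable [measurable (raw)]:
  fixes f g :: "'m \<Rightarrow> 'a::{complex_hilbert, second_countable_topology}"
  assumes "f \<in> borel_measurable M" "g \<in> borel_measurable M"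
  shows "(\<lambda>z. cinner (f z) (g z)) \<in> borel_measurable M"
  by (rule borel_measurable_continuous_Pair[OF assms])
    (intro bounded_bilinear.continuous_on[OF bounded_bilinear_cinner] continuous_intros)

lemma powi_measurable [measurable]: "(\<lambda>z::complex. z powi n) \<in> borel_measurable borel"
  by (cases "n \<ge> 0") (simp_all add: power_int_def)

lemma two_mult_le_squares: "2 * (a * b) \<le> a\<^sup>2 + (b::real)\<^sup>2"
  using sum_squares_bound[of a b] by (simp add: mult.assoc)

lemma le_two_squares: "x \<le> 1 * (x\<^sup>2 + x\<^sup>2) + (1::real)"
proof -
  have *: "x \<le> 1 * (y + y) + 1" if "2 * x \<le> y + 1" "0 \<le> y" for y :: real
    using that by simp
  show ?thesis
    using two_mult_le_squares[of x 1] by (intro *) simp_all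
qed

lemma square_integrable_add:
  assumes "square_integrable f" "square_integrable g"
  shows "square_integrable (\<lambda>z. f z + g z)"
proof -
  have [measurable]: "f \<in> borel_measurable circle_measure" "g \<in> borel_measurable circle_measure"
    using assms by (auto simp: square_integrable_def)
  have "norm ((norm (f z + g z))\<^sup>2) \<le> 2 * ((norm (f z))\<^sup>2 + (norm (g z))\<^sup>2) + 0" for z
  proof -
    have "(norm (f z + g z))\<^sup>2 \<le> (norm (f z) + norm (g z))\<^sup>2"
      by (intro power_mono norm_triangle_ineq norm_ge_zero)
    then show ?thesis
      using two_mult_le_squares[of "norm (f z)" "norm (g z)"] by (simp add: power2_sum)
  qed
  then have "integrable circle_measure (\<lambda>z. (norm (f z + g z))\<^sup>2)"
    by (intro integrable_bound_sq[OF assms, where C = 2 and D = 0]) auto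
  then show ?thesis
    by (simp add: square_integrable_def)
qed

lemma square_integrable_bounded_image:
  assumes "square_integrable f" "h \<in> borel_measurable circle_measure"
    and "AE z in circle_measure. norm (h z) \<le> K * norm (f z)"
  shows "square_integrable h"
proof -
  note [measurable] = assms(2)
  have "AE z in circle_measure. norm ((norm (h z))\<^sup>2) \<le> K\<^sup>2 * ((norm (f z))\<^sup>2 + (norm (f z))\<^sup>2) + 0"
    using assms(3)
  proof eventually_elim
    case (elim z)
    then have "(norm (h z))\<^sup>2 \<le> (K * norm (f z))\<^sup>2"
      by (intro power_mono) auto
    also have "\<dots> \<le> K\<^sup>2 * ((norm (f z))\<^sup>2 + (norm (f z))\<^sup>2)"
      by (simp add: power_mult_distrib algebra_simps)
    finally show ?case by simp
  qed
  then have "integrable circle_measure (\<lambda>z. (norm (h z))\<^sup>2)"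
    by (intro integrable_bound_sq[OF assms(1,1), where C = "K\<^sup>2" and D = 0]) auto
  then show ?thesis
    using assms(2) by (simp add: square_integrable_def)
qed

lemma integrable_fourier:
  assumes "square_integrable f"
  shows "integrable circle_measure (\<lambda>z. (z powi n) *\<^sub>C f z)"
proof (rule integrable_bound_sq[OF assms assms])
  have [measurable]: "f \<in> borel_measurable circle_measure"
    using assms by (auto simp: square_integrable_def)
  show "(\<lambda>z. (z powi n) *\<^sub>C f z) \<in> borel_measurable circle_measure" by measurable
  show "AE z in circle_measure. norm ((z powi n) *\<^sub>C f z) \<le> 1 * ((norm (f z))\<^sup>2 + (norm (f z))\<^sup>2) + 1"
    using AE_circle_norm
  proof eventually_elim
    case (elim z)
    then show ?case
    proof -
      have "norm (f z) \<le> 1 * ((norm (f z))\<^sup>2 + (norm (f z))\<^sup>2) + 1"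
        by (rule le_two_squares)
      then show ?thesis
        using elim by (simp add: norm_scaleC norm_power_int)
    qed
  qed
qed

lemma hardy_fun_add:
  assumes "hardy_fun f" "hardy_fun g"
  shows "hardy_fun (\<lambda>z. f z + g z)"
  using assms unfolding hardy_fun_def fourier_coeff_def
  by (auto simp: square_integrable_add scaleC_add_right integrable_fourier)

lemma fourier_coeff_bounded_clinear:
  assumes "square_integrable f" "bounded_clinear A"
  shows "fourier_coeff (\<lambda>z. A (f z)) n = A (fourier_coeff f n)"
  using integral_bounded_linear[of A circle_measure "\<lambda>z. (z powi (- n)) *\<^sub>C f z"] assms
  by (simp add: fourier_coeff_def bounded_clinear_def integrable_fourier)

lemma hardy_fun_bounded_clinear:
  assumes "hardy_fun f" "bounded_clinear A"
  shows "hardy_fun (\<lambda>z. A (f z))"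
proof -
  have bl: "bounded_linear A" and sq: "square_integrable f"
    using assms by (auto simp: bounded_clinear_def hardy_fun_def)
  obtain K where K: "norm (A x) \<le> norm x * K" for x
    using bounded_linear.bounded[OF bl] by blast
  have [measurable]: "f \<in> borel_measurable circle_measure"
    using sq by (auto simp: square_integrable_def)
  have [measurable]: "A \<in> borel_measurable borel"
    using bl by (intro borel_measurable_continuous_onI linear_continuous_on)
  have "square_integrable (\<lambda>z. A (f z))"
    by (rule square_integrable_bounded_image[OF sq, where K = K])
      (auto simp: K mult.commute[of K])
  moreover have "A 0 = 0"
    using bl by (simp add: linear_simps)
  ultimately show ?thesis
    using assms sq by (auto simp: hardy_fun_def fourier_coeff_bounded_clinear)
qed

lemma hardy_fun_mult_z:
  assumes "hardy_fun f"
  shows "hardy_fun (\<lambda>z. z *\<^sub>C f z)"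
proof -
  have sq: "square_integrable f"
    using assms by (auto simp: hardy_fun_def)
  have [measurable]: "f \<in> borel_measurable circle_measure"
    using sq by (auto simp: square_integrable_def)
  have "AE z in circle_measure. norm (z *\<^sub>C f z) \<le> 1 * norm (f z)"
    using AE_circle_norm by eventually_elim (simp add: norm_scaleC)
  then have "square_integrable (\<lambda>z. z *\<^sub>C f z)"
    by (intro square_integrable_bounded_image[OF sq, where K = 1]) auto
  moreover have "fourier_coeff (\<lambda>z. z *\<^sub>C f z) n = fourier_coeff f (n - 1)" for n
    unfolding fourier_coeff_def
  proof (rule integral_cong_AE)
    show "AE z in circle_measure. z powi (- n) *\<^sub>C z *\<^sub>C f z = z powi (- (n - 1)) *\<^sub>C f z"
      using AE_circle_norm
    proof eventually_elim
      case (elim z)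
      then have "z \<noteq> 0" by auto
      then have "z powi (- n) * z = z powi (- n + 1)"
        by (metis power_int_add power_int_1_right)
      then show ?case by (simp add: scaleC_scaleC)
    qed
  qed measurable
  ultimately show ?thesis
    using assms by (auto simp: hardy_fun_def)
qed

lemma bounded_clinear_scaleC: "bounded_clinear (\<lambda>x. c *\<^sub>C x)"
  by (auto simp: bounded_clinear_def scaleC_scaleC mult.commute
      intro: bounded_bilinear.bounded_linear_right[OF bounded_bilinear_scaleC])

lemma hardy_fun_scaleC: "hardy_fun f \<Longrightarrow> hardy_fun (\<lambda>z. c *\<^sub>C f z)"
  by (rule hardy_fun_bounded_clinear[OF _ bounded_clinear_scaleC])

lemma hardy_fun_scaleR: "hardy_fun f \<Longrightarrow> hardy_fun (\<lambda>z. r *\<^sub>R f z)"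
  using hardy_fun_scaleC[of f "complex_of_real r"] by (simp add: scaleC_of_real)

lemma hardy_fun_minus: "hardy_fun f \<Longrightarrow> hardy_fun (\<lambda>z. - f z)"
  using hardy_fun_scaleR[of f "-1"] by simp

lemma hardy_fun_diff: "hardy_fun f \<Longrightarrow> hardy_fun g \<Longrightarrow> hardy_fun (\<lambda>z. f z - g z)"
  using hardy_fun_add[of f "\<lambda>z. - g z"] hardy_fun_minus[of g] by simp

lemma hardy_fun_zero: "hardy_fun (\<lambda>z. 0)"
  by (simp add: hardy_fun_def square_integrable_def fourier_coeff_def)

text \<open>The elements of the Hardy space are almost-everywhere classes of functions; values off the
  circle are irrelevant.\<close>

quotient_type (overloaded) 'a hardy =
  "complex \<Rightarrow> 'a::{complex_hilbert, second_countable_topology}" / partial: hardy_rel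
proof (rule part_equivpI)
  show "\<exists>f. hardy_rel f (f :: complex \<Rightarrow> 'a)"
    using hardy_fun_zero unfolding hardy_rel_def by blast
  show "symp (hardy_rel :: (complex \<Rightarrow> 'a) \<Rightarrow> _)"
    by (auto simp: symp_def hardy_rel_def elim!: eventually_mono)
  show "transp (hardy_rel :: (complex \<Rightarrow> 'a) \<Rightarrow> _)"
    by (auto simp: transp_def hardy_rel_def elim: eventually_elim2)
qed

lemma integrable_cinner:
  fixes f g :: "complex \<Rightarrow> 'a::{complex_hilbert, second_countable_topology}"
  assumes "hardy_fun f" "hardy_fun g"
  shows "integrable circle_measure (\<lambda>z. cinner (f z) (g z))"
proof -
  have sq: "square_integrable f" "square_integrable g"
    using assms by (auto simp: hardy_fun_def)
  then have [measurable]: "f \<in> borel_measurable circle_measure" "g \<in> borel_measurable circle_measure"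
    by (auto simp: square_integrable_def)
  have "norm (cinner (f z) (g z)) \<le> 1 * ((norm (f z))\<^sup>2 + (norm (g z))\<^sup>2) + 0" for z
    using norm_cinner_le[of "f z" "g z"] two_mult_le_squares[of "norm (f z)" "norm (g z)"] by simp
  then show ?thesis
    by (intro integrable_bound_sq[OF sq, where C = 1 and D = 0]) auto
qed

lemma integral_inner_eq_Re:
  fixes f g :: "complex \<Rightarrow> 'a::{complex_hilbert, second_countable_topology}"
  assumes "hardy_fun f" "hardy_fun g"
  shows "(LINT z|circle_measure. inner (f z) (g z)) = Re (LINT z|circle_measure. cinner (f z) (g z))"
  using integral_Re[OF integrable_cinner[OF assms]] by (simp add: Re_cinner)

lemma integrable_inner:
  fixes f g :: "complex \<Rightarrow> 'a::{complex_hilbert, second_countable_topology}"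
  assumes "hardy_fun f" "hardy_fun g"
  shows "integrable circle_measure (\<lambda>z. inner (f z) (g z))"
  using integrable_Re[OF integrable_cinner[OF assms]] by (simp add: Re_cinner)

lemma integral_cinner_commute:
  fixes f g :: "complex \<Rightarrow> 'a::{complex_hilbert, second_countable_topology}"
  shows "(LINT z|circle_measure. cinner (f z) (g z)) = cnj (LINT z|circle_measure. cinner (g z) (f z))"
proof -
  have "(LINT z|circle_measure. cinner (f z) (g z)) = (LINT z|circle_measure. cnj (cinner (g z) (f z)))"
    by (rule Bochner_Integration.integral_cong[OF refl]) (rule cinner_commute)
  then show ?thesis by simp
qed

instantiation hardy :: ("{complex_hilbert, second_countable_topology}") complex_inner
begin

lift_definition zero_hardy :: "'a hardy" is "\<lambda>_. 0"
  by (simp add: hardy_rel_def hardy_fun_zero)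

lift_definition plus_hardy :: "'a hardy \<Rightarrow> 'a hardy \<Rightarrow> 'a hardy" is "\<lambda>f g z. f z + g z"
  by (auto simp: hardy_rel_def hardy_fun_add elim: eventually_elim2)

lift_definition minus_hardy :: "'a hardy \<Rightarrow> 'a hardy \<Rightarrow> 'a hardy" is "\<lambda>f g z. f z - g z"
  by (auto simp: hardy_rel_def hardy_fun_diff elim: eventually_elim2)

lift_definition uminus_hardy :: "'a hardy \<Rightarrow> 'a hardy" is "\<lambda>f z. - f z"
  by (auto simp: hardy_rel_def hardy_fun_minus elim!: eventually_mono)

lift_definition scaleR_hardy :: "real \<Rightarrow> 'a hardy \<Rightarrow> 'a hardy" is "\<lambda>r f z. r *\<^sub>R f z"
  by (auto simp: hardy_rel_def hardy_fun_scaleR elim!: eventually_mono)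

lift_definition scaleC_hardy :: "complex \<Rightarrow> 'a hardy \<Rightarrow> 'a hardy" is "\<lambda>c f z. c *\<^sub>C f z"
  by (auto simp: hardy_rel_def hardy_fun_scaleC elim!: eventually_mono)

lift_definition cinner_hardy :: "'a hardy \<Rightarrow> 'a hardy \<Rightarrow> complex"
  is "\<lambda>f g. LINT z|circle_measure. cinner (f z) (g z)"
  by (rule integral_cong_AE)
    (auto simp: hardy_rel_def hardy_fun_def square_integrable_def elim: eventually_elim2)

definition inner_hardy :: "'a hardy \<Rightarrow> 'a hardy \<Rightarrow> real"
  where "inner_hardy f g = Re (cinner f g)"

definition norm_hardy :: "'a hardy \<Rightarrow> real"
  where "norm_hardy f = sqrt (inner f f)"

definition sgn_hardy :: "'a hardy \<Rightarrow> 'a hardy"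
  where "sgn_hardy f = inverse (norm f) *\<^sub>R f"

definition dist_hardy :: "'a hardy \<Rightarrow> 'a hardy \<Rightarrow> real"
  where "dist_hardy f g = norm (f - g)"

definition uniformity_hardy :: "('a hardy \<times> 'a hardy) filter"
  where "uniformity_hardy = (INF e\<in>{0 <..}. principal {(x, y). dist x y < e})"

definition open_hardy :: "'a hardy set \<Rightarrow> bool"
  where "open_hardy U \<longleftrightarrow> (\<forall>x\<in>U. eventually (\<lambda>(x', y). x' = x \<longrightarrow> y \<in> U) uniformity)"

instance
proof
  fix f g h :: "'a hardy" and r s :: real and c d :: complex and U :: "'a hardy set"
  show "f + g + h = f + (g + h)"
    by transfer (auto simp: hardy_rel_def hardy_fun_add add.assoc)
  show "f + g = g + f"
    by transfer (auto simp: hardy_rel_def hardy_fun_add add.commute)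
  show "0 + f = f"
    by transfer (auto simp: hardy_rel_def)
  show "- f + f = 0"
    by transfer (auto simp: hardy_rel_def hardy_fun_zero)
  show "f - g = f + - g"
    by transfer (auto simp: hardy_rel_def hardy_fun_diff)
  show "r *\<^sub>R (f + g) = r *\<^sub>R f + r *\<^sub>R g"
    by transfer (auto simp: hardy_rel_def hardy_fun_add hardy_fun_scaleR scaleR_add_right)
  show "(r + s) *\<^sub>R f = r *\<^sub>R f + s *\<^sub>R f"
    by transfer (auto simp: hardy_rel_def hardy_fun_add hardy_fun_scaleR scaleR_add_left)
  show "r *\<^sub>R s *\<^sub>R f = (r * s) *\<^sub>R f"
    by transfer (auto simp: hardy_rel_def hardy_fun_scaleR)
  show "1 *\<^sub>R f = f"
    by transfer (auto simp: hardy_rel_def)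
  show "sgn f = inverse (norm f) *\<^sub>R f" by (rule sgn_hardy_def)
  show "dist f g = norm (f - g)" by (rule dist_hardy_def)
  show "uniformity = (INF e\<in>{0 <..}. principal {(x, y::'a hardy). dist x y < e})"
    by (rule uniformity_hardy_def)
  show "open U \<longleftrightarrow> (\<forall>x\<in>U. eventually (\<lambda>(x', y). x' = x \<longrightarrow> y \<in> U) uniformity)"
    by (rule open_hardy_def)
  show "norm f = sqrt (inner f f)" by (rule norm_hardy_def)
  show "Re (cinner f g) = inner f g" by (simp add: inner_hardy_def)
  show commute: "cinner f g = cnj (cinner g f)" for f g :: "'a hardy"
    by transfer (metis integral_cinner_commute)
  show add: "cinner (f + g) h = cinner f h + cinner g h"
    by transfer (auto simp: hardy_rel_def cinner_add_left integrable_cinner)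
  show scale: "cinner (c *\<^sub>C f) g = c * cinner f g" for c and f g :: "'a hardy"
    by transfer (auto simp: cinner_scaleC_left)
  show "c *\<^sub>C (f + g) = c *\<^sub>C f + c *\<^sub>C g"
    by transfer (auto simp: hardy_rel_def hardy_fun_add hardy_fun_scaleC scaleC_add_right)
  show "(c + d) *\<^sub>C f = c *\<^sub>C f + d *\<^sub>C f"
    by transfer (auto simp: hardy_rel_def hardy_fun_add hardy_fun_scaleC scaleC_add_left)
  show "c *\<^sub>C (d *\<^sub>C f) = (c * d) *\<^sub>C f"
    by transfer (auto simp: hardy_rel_def hardy_fun_scaleC scaleC_scaleC)
  show ofreal: "complex_of_real r *\<^sub>C f = r *\<^sub>R f" for r and f :: "'a hardy"
    by transfer (auto simp: hardy_rel_def hardy_fun_scaleR scaleC_of_real)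
  show "inner f g = inner g f"
    unfolding inner_hardy_def by (subst commute) simp
  show "inner (f + g) h = inner f h + inner g h"
    by (simp add: inner_hardy_def add)
  show "inner (r *\<^sub>R f) g = r * inner f g"
    by (simp add: inner_hardy_def ofreal[symmetric] scale)
  have pos: "0 \<le> inner f f \<and> (inner f f = 0 \<longleftrightarrow> f = 0)"
    unfolding inner_hardy_def
  proof transfer
    fix f :: "complex \<Rightarrow> 'a"
    assume "hardy_rel f f"
    then have f: "hardy_fun f" by (simp add: hardy_rel_def)
    have eq: "Re (LINT z|circle_measure. cinner (f z) (f z)) = (LINT z|circle_measure. inner (f z) (f z))"
      using integral_inner_eq_Re[OF f f] by simp
    have "(LINT z|circle_measure. inner (f z) (f z)) = 0 \<longleftrightarrow> (AE z in circle_measure. inner (f z) (f z) = 0)"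
      by (rule integral_nonneg_eq_0_iff_AE[OF integrable_inner[OF f f]]) simp
    then show "0 \<le> Re (LINT z|circle_measure. cinner (f z) (f z)) \<and>
      (Re (LINT z|circle_measure. cinner (f z) (f z)) = 0 \<longleftrightarrow> hardy_rel f (\<lambda>_. 0))"
      unfolding eq using f by (simp add: hardy_rel_def hardy_fun_zero)
  qed
  show "0 \<le> inner f f" "inner f f = 0 \<longleftrightarrow> f = 0" using pos by auto
qed

end

lemma hardy_fun_elem_tensor:
  fixes v :: "'s::{complex_hilbert, second_countable_topology}"
  assumes "hardy_fun h"
  shows "hardy_fun (\<lambda>z. h z *\<^sub>C v)"
proof -
  have "bounded_clinear (\<lambda>c. c *\<^sub>C v)"
    by (auto simp: bounded_clinear_def scaleC_scaleC scaleC_complex_def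
        intro: bounded_bilinear.bounded_linear_left[OF bounded_bilinear_scaleC])
  then show ?thesis
    using hardy_fun_bounded_clinear[OF assms] by blast
qed

text \<open>The space \<open>'s hardy\<close> is identified with the Hilbert space tensor product of \<open>complex hardy\<close>
  and \<open>'s\<close>: the elementary tensor of \<open>h\<close> and \<open>v\<close> is the function mapping \<open>z\<close> to \<open>h z *\<^sub>C v\<close>.\<close>

lift_definition elem_tensor ::
    "complex hardy \<Rightarrow> 's::{complex_hilbert, second_countable_topology} \<Rightarrow> 's hardy"
  is "\<lambda>h v z. h z *\<^sub>C v"
  by (auto simp: hardy_rel_def hardy_fun_elem_tensor elim!: eventually_mono)

lift_definition S_z :: "complex hardy \<Rightarrow> complex hardy" is "\<lambda>h z. z * h z"
  using hardy_fun_mult_z[where ?'a = complex]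
  by (auto simp: hardy_rel_def scaleC_complex_def elim!: eventually_mono)

text \<open>\<open>I_tensor A\<close> and \<open>S_z_tensor A\<close> are the operators written \<open>I \<otimes> A\<close> and \<open>S\<^sub>z \<otimes> A\<close>, that is,
  multiplication by the operator-valued functions \<open>A\<close> and \<open>z A\<close>. The choice of the representative
  is immaterial for \<open>bounded_clinear A\<close>, the only case of interest, and the action on elementary
  tensors is the expected one: see \<open>I_tensor_elem\<close> and \<open>S_z_tensor_elem\<close> below.\<close>

definition I_tensor :: "('s \<Rightarrow> 's) \<Rightarrow> 's::{complex_hilbert, second_countable_topology} hardy \<Rightarrow> 's hardy"
  where "I_tensor A f = abs_hardy (\<lambda>z. A (rep_hardy f z))"

definition S_z_tensor :: "('s \<Rightarrow> 's) \<Rightarrow> 's::{complex_hilbert, second_countable_topology} hardy \<Rightarrow> 's hardy"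
  where "S_z_tensor A f = abs_hardy (\<lambda>z. z *\<^sub>C A (rep_hardy f z))"

lemma hardy_rel_rep_abs: "hardy_fun f \<Longrightarrow> hardy_rel (rep_hardy (abs_hardy f)) f"
  by (rule rep_abs_rsp_left[OF Quotient3_hardy]) (simp add: hardy_rel_def)

lemma abs_hardy_eqI: "hardy_rel f g \<Longrightarrow> abs_hardy f = abs_hardy g"
  by (rule Quotient3_rel_abs[OF Quotient3_hardy])

lemma I_tensor_abs:
  assumes "bounded_clinear A" "hardy_fun f"
  shows "I_tensor A (abs_hardy f) = abs_hardy (\<lambda>z. A (f z))"
  unfolding I_tensor_def using hardy_rel_rep_abs[OF assms(2)]
  by (intro abs_hardy_eqI)
    (auto simp: hardy_rel_def hardy_fun_bounded_clinear[OF _ assms(1)] elim!: eventually_mono)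

lemma S_z_tensor_abs:
  assumes "bounded_clinear A" "hardy_fun f"
  shows "S_z_tensor A (abs_hardy f) = abs_hardy (\<lambda>z. z *\<^sub>C A (f z))"
  unfolding S_z_tensor_def using hardy_rel_rep_abs[OF assms(2)]
  by (intro abs_hardy_eqI)
    (auto simp: hardy_rel_def hardy_fun_mult_z[OF hardy_fun_bounded_clinear[OF _ assms(1)]]
      elim!: eventually_mono)

lemma hardy_fun_rep: "hardy_fun (rep_hardy f)"
  using Quotient3_rep_reflp[OF Quotient3_hardy, of f] by (simp add: hardy_rel_def)

lemma abs_rep_hardy: "abs_hardy (rep_hardy f) = f"
  by (rule Quotient3_abs_rep[OF Quotient3_hardy])

lemma elem_tensor_abs: "hardy_fun h \<Longrightarrow> elem_tensor (abs_hardy h) v = abs_hardy (\<lambda>z. h z *\<^sub>C v)"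
  by (rule elem_tensor.abs_eq) (simp add: hardy_rel_def)

lemma S_z_abs: "hardy_fun h \<Longrightarrow> S_z (abs_hardy h) = abs_hardy (\<lambda>z. z * h z)"
  by (rule S_z.abs_eq) (simp add: hardy_rel_def)

lemma I_tensor_elem:
  assumes "bounded_clinear A"
  shows "I_tensor A (elem_tensor h v) = elem_tensor h (A v)"
proof -
  obtain f where f: "h = abs_hardy f" "hardy_fun f"
    using abs_rep_hardy hardy_fun_rep by metis
  show ?thesis
    using assms unfolding f(1) elem_tensor_abs[OF f(2)]
    by (simp add: I_tensor_abs hardy_fun_elem_tensor f(2)) (simp add: bounded_clinear_def)
qed

lemma S_z_tensor_elem:
  assumes "bounded_clinear A"
  shows "S_z_tensor A (elem_tensor h v) = elem_tensor (S_z h) (A v)"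
proof -
  obtain f where f: "h = abs_hardy f" "hardy_fun f"
    using abs_rep_hardy hardy_fun_rep by metis
  have "hardy_fun (\<lambda>z. z * f z)"
    using hardy_fun_mult_z[OF f(2)] by (simp add: scaleC_complex_def)
  then show ?thesis
    using assms unfolding f(1) elem_tensor_abs[OF f(2)] S_z_abs[OF f(2)]
    by (simp add: S_z_tensor_abs elem_tensor_abs hardy_fun_elem_tensor f(2))
      (simp add: bounded_clinear_def scaleC_scaleC)
qed

text \<open>Separability of the coefficient space is the sort \<open>second_countable_topology\<close>.\<close>

definition bcl_triple :: "('s::{complex_hilbert, second_countable_topology} \<Rightarrow> 's) \<Rightarrow> ('s \<Rightarrow> 's) \<Rightarrow> bool"
  where "bcl_triple U P \<longleftrightarrow> unitary_op U \<and> orth_projection P"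

definition M_phi1 :: "('s::{complex_hilbert, second_countable_topology} \<Rightarrow> 's) \<Rightarrow> ('s \<Rightarrow> 's)
    \<Rightarrow> 's hardy \<Rightarrow> 's hardy"
  where "M_phi1 U P = (\<lambda>f. I_tensor (P \<circ> cadjoint U) f + S_z_tensor (compl_proj P \<circ> cadjoint U) f)"

definition M_phi2 :: "('s::{complex_hilbert, second_countable_topology} \<Rightarrow> 's) \<Rightarrow> ('s \<Rightarrow> 's)
    \<Rightarrow> 's hardy \<Rightarrow> 's hardy"
  where "M_phi2 U P = (\<lambda>f. I_tensor (U \<circ> compl_proj P) f + S_z_tensor (U \<circ> P) f)"

definition H_op :: "('h::complex_inner \<Rightarrow> 'h) \<Rightarrow> ('h \<Rightarrow> 'h) \<Rightarrow> 'h \<Rightarrow> 'h"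
  where "H_op V1 V2 = (\<lambda>x.
      (V2 \<circ> cadjoint V2) x
    - (V1 \<circ> cadjoint V1) x
    - (V2 \<circ> V2 \<circ> cadjoint V2 \<circ> cadjoint V2) x
    + (V1 \<circ> V2 \<circ> cadjoint V1 \<circ> cadjoint V2) x)"

end

theory Submission
  imports Defs
begin

text \<open>Let \<open>S\<close> be the shift on the vector-valued Hardy space, let \<open>c\<close> take the constant Fourier
  coefficient, let \<open>K\<close> embed constants, and write \<open>V\<^sub>1, V\<^sub>2\<close> for the BCL pair. Then
  \<open>V\<^sub>1 V\<^sub>1\<^sup>* = I - K P\<^sup>\<bottom> c\<close>, \<open>V\<^sub>2 V\<^sub>2\<^sup>* = I - K (U P U\<^sup>*) c\<close> and \<open>V\<^sub>1 V\<^sub>2 = S\<close>, so everything cancels up to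
  \<open>H = V\<^sub>2 K (U P U\<^sup>*) c V\<^sub>2\<^sup>* - K P c\<close>. The values of \<open>H\<close> are of the form \<open>a + b z\<close>; evaluating on
  constants and on shifted constants turns \<open>H = 0\<close> into equations on \<open>U\<close> and \<open>P\<close>. One of them is
  \<open>P U P U\<^sup>* P = 0\<close>, i.e. \<open>(P U P) (P U P)\<^sup>* = 0\<close>, which forces \<open>P U P = 0\<close>; the others then reduce to
  \<open>U\<^sup>2 P U\<^sup>*\<^sup>2 = P\<close>.\<close>

section \<open>Fourier coefficients\<close>

lemma integral_circle_measure:
  fixes g :: "complex \<Rightarrow> 'b::{banach, second_countable_topology}"
  assumes [measurable]: "g \<in> borel_measurable borel"
  shows "(LINT z|circle_measure. g z) = (1 / (2 * pi)) *\<^sub>R (LINT t:{0..2 * pi}|lborel. g (cis t))"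
proof -
  have [measurable]: "cis \<in> borel_measurable borel"
    by (intro borel_measurable_continuous_onI continuous_intros)
  \<comment> \<open>The interval has length \<open>2 * pi\<close>, which gives the constant in the
    density. The real-valued form is what \<open>integral_density\<close> takes.\<close>
  have um: "uniform_measure lborel {0..2 * pi}
      = density lborel (\<lambda>t. ennreal (indicator {0..2 * pi} t / (2 * pi)))"
    unfolding uniform_measure_def
    by (rule density_cong) (auto simp: indicator_def divide_ennreal[symmetric])
  have "(LINT z|circle_measure. g z) = (LINT t|uniform_measure lborel {0..2 * pi}. g (cis t))"
    unfolding circle_measure_def by (rule integral_distr) (auto intro: cis_measurable)
  also have "\<dots> = (LINT t|lborel. (indicator {0..2 * pi} t / (2 * pi)) *\<^sub>R g (cis t))"
    unfolding um by (rule integral_density) auto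
  also have "\<dots> = (LINT t|lborel. (1 / (2 * pi)) *\<^sub>R (indicator {0..2 * pi} t *\<^sub>R g (cis t)))"
    by (simp add: field_simps)
  finally show ?thesis
    by (simp only: integral_scaleR_right set_lebesgue_integral_def)
qed

lemma integral_circle_powi:
  "(LINT z|circle_measure. z powi n) = (if n = 0 then 1 else (0::complex))"
proof (cases "n = 0")
  case True
  have "(LINT z|circle_measure. (1::complex)) = 1"
    by (simp add: measure_def emeasure_circle_measure_UNIV)
  then show ?thesis using True by simp
next
  case False
  have "(LINT t:{0..2 * pi}|lborel. cis t powi n)
      = cis (of_int n * (2 * pi)) / (\<i> * of_int n) - cis (of_int n * 0) / (\<i> * of_int n)"
    unfolding set_lebesgue_integral_def
  \<comment> \<open>For \<open>n \<noteq> 0\<close> the antiderivative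
    \<open>cis (n t) / (i n)\<close> has period \<open>2 * pi\<close>, so its two boundary values
    cancel.\<close>
  proof (rule integral_FTC_Icc[where F = "\<lambda>t. cis (of_int n * t) / (\<i> * of_int n)"])
    fix t :: real assume "0 \<le> t" "t \<le> 2 * pi"
    show "((\<lambda>t. cis (of_int n * t) / (\<i> * of_int n)) has_vector_derivative cis t powi n) (at t within {0..2 * pi})"
      unfolding cis_power_int unfolding cis_conv_exp of_real_mult of_real_of_int_eq
      by (rule has_vector_derivative_real_field)
        (use False in \<open>auto intro!: derivative_eq_intros simp: field_simps\<close>)
  next
    show "continuous_on {0..2 * pi} (\<lambda>t. cis t powi n)"
      unfolding cis_power_int by (intro continuous_intros)
  qed simp
  also have "cis (of_int n * (2 * pi)) = 1"
    using cis_multiple_2pi[of "of_int n"] by (simp add: mult.commute mult.left_commute)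
  finally show ?thesis
    using False by (simp add: integral_circle_measure)
qed

lemma square_integrable_const: "square_integrable (\<lambda>_. v)"
  by (simp add: square_integrable_def)

text \<open>The constant \<open>v\<close> is the image of the scalar constant 1 under the bounded
  linear map \<open>c \<mapsto> c *\<^sub>C v\<close>, and such maps commute with Fourier
  coefficients. Only the scalar integral of \<open>z powi (- n)\<close> remains.\<close>

lemma fourier_coeff_const: "fourier_coeff (\<lambda>_. v) n = (if n = 0 then v else 0)"
proof -
  have "fourier_coeff (\<lambda>_. v) n = fourier_coeff (\<lambda>_. 1::complex) n *\<^sub>C v"
    using fourier_coeff_bounded_clinear[of "\<lambda>_. 1::complex" "\<lambda>c. c *\<^sub>C v" n]
    by (simp add: square_integrable_const bounded_clinear_def scaleC_scaleC scaleC_complex_def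
        bounded_bilinear.bounded_linear_left[OF bounded_bilinear_scaleC])
  also have "fourier_coeff (\<lambda>_. 1::complex) n = (if n = 0 then 1 else 0)"
    by (simp add: fourier_coeff_def scaleC_complex_def integral_circle_powi)
  finally show ?thesis
    by (auto simp: bounded_bilinear.zero_left[OF bounded_bilinear_scaleC])
qed

lemma fourier_coeff_cong_AE:
  assumes "square_integrable f" "square_integrable g" "AE z in circle_measure. f z = g z"
  shows "fourier_coeff f n = fourier_coeff g n"
proof -
  have [measurable]: "f \<in> borel_measurable circle_measure" "g \<in> borel_measurable circle_measure"
    using assms by (auto simp: square_integrable_def)
  show ?thesis
    unfolding fourier_coeff_def using assms(3)
    by (intro integral_cong_AE) (auto elim!: eventually_mono)
qed

lemma fourier_coeff_add:
  assumes "square_integrable f" "square_integrable g"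
  shows "fourier_coeff (\<lambda>z. f z + g z) n = fourier_coeff f n + fourier_coeff g n"
  using assms unfolding fourier_coeff_def by (simp add: integrable_fourier scaleC_add_right)

lemma fourier_coeff_diff:
  assumes "square_integrable f" "square_integrable g"
  shows "fourier_coeff (\<lambda>z. f z - g z) n = fourier_coeff f n - fourier_coeff g n"
  using assms unfolding fourier_coeff_def
  by (simp add: integrable_fourier bounded_bilinear.diff_right[OF bounded_bilinear_scaleC])

text \<open>Almost every \<open>z\<close> is nonzero, so exponents add even when negative. The case
  \<open>k = 1\<close> serves the shift, \<open>k = - 1\<close> the backward shift.\<close>

lemma fourier_coeff_mult_powi:
  assumes "square_integrable f"
  shows "fourier_coeff (\<lambda>z. (z powi k) *\<^sub>C f z) n = fourier_coeff f (n - k)"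
  unfolding fourier_coeff_def
proof (rule integral_cong_AE)
  have [measurable]: "f \<in> borel_measurable circle_measure"
    using assms by (auto simp: square_integrable_def)
  show "(\<lambda>z. z powi (- n) *\<^sub>C (z powi k) *\<^sub>C f z) \<in> borel_measurable circle_measure"
    "(\<lambda>z. z powi (- (n - k)) *\<^sub>C f z) \<in> borel_measurable circle_measure"
    by measurable
  show "AE z in circle_measure. z powi (- n) *\<^sub>C (z powi k) *\<^sub>C f z = z powi (- (n - k)) *\<^sub>C f z"
    using AE_circle_norm
  proof eventually_elim
    case (elim z)
    then have "z \<noteq> 0" by auto
    then have "z powi (- n) * z powi k = z powi (- (n - k))"
      by (simp add: power_int_add[symmetric])
    then show ?case by (simp add: scaleC_scaleC)
  qed
qed

section \<open>The backward shift\<close>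

lemma hardy_fun_const: "hardy_fun (\<lambda>_. v)"
  by (simp add: hardy_fun_def square_integrable_const fourier_coeff_const)

text \<open>Dividing by \<open>z\<close> lowers every index by one. The only coefficient that could
  move to a negative index is the constant one, and it has been subtracted.\<close>

lemma hardy_fun_backshift:
  assumes "hardy_fun f"
  shows "hardy_fun (\<lambda>z. inverse z *\<^sub>C (f z - fourier_coeff f 0))"
proof -
  let ?g = "\<lambda>z. f z - fourier_coeff f 0"
  have g: "hardy_fun ?g"
    using assms by (rule hardy_fun_diff[OF _ hardy_fun_const])
  then have sq: "square_integrable ?g" and [measurable]: "?g \<in> borel_measurable circle_measure"
    by (auto simp: hardy_fun_def square_integrable_def)
  have "AE z in circle_measure. norm (inverse z *\<^sub>C ?g z) \<le> 1 * norm (?g z)"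
    using AE_circle_norm by eventually_elim (simp add: norm_scaleC norm_inverse)
  then have "square_integrable (\<lambda>z. inverse z *\<^sub>C ?g z)"
    by (intro square_integrable_bounded_image[OF sq, where K = 1]) measurable
  moreover have "fourier_coeff ?g 0 = 0"
    using assms
    by (simp add: fourier_coeff_diff fourier_coeff_const square_integrable_const hardy_fun_def)
  then have "fourier_coeff ?g (n + 1) = 0" if "n < 0" for n
    \<comment> \<open>The case \<open>n = - 1\<close> is the subtracted coefficient; otherwise
      \<open>n + 1\<close> is still negative.\<close>
    using g that by (cases "n + 1 = 0") (auto simp: hardy_fun_def)
  ultimately show ?thesis
    by (simp add: hardy_fun_def fourier_coeff_mult_powi[OF sq, of "- 1", simplified])
qed

lift_definition hardy_const :: "'s::{complex_hilbert, second_countable_topology} \<Rightarrow> 's hardy"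
  is "\<lambda>v _. v"
  by (simp add: hardy_rel_def hardy_fun_const)

lift_definition hardy_coeff0 :: "'s::{complex_hilbert, second_countable_topology} hardy \<Rightarrow> 's"
  is "\<lambda>f. fourier_coeff f 0"
  by (auto simp: hardy_rel_def hardy_fun_def intro: fourier_coeff_cong_AE)

lift_definition shift :: "'s::{complex_hilbert, second_countable_topology} hardy \<Rightarrow> 's hardy"
  is "\<lambda>f z. z *\<^sub>C f z"
  by (auto simp: hardy_rel_def hardy_fun_mult_z elim!: eventually_mono)

text \<open>On the circle \<open>inverse z\<close> is the conjugate of \<open>z\<close>; this is the
  adjoint of \<open>shift\<close>. The value at \<open>z = 0\<close> lies off the circle and does
  not matter.\<close>

lift_definition backshift :: "'s::{complex_hilbert, second_countable_topology} hardy \<Rightarrow> 's hardy"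
  is "\<lambda>f z. inverse z *\<^sub>C (f z - fourier_coeff f 0)"
proof -
  fix f g :: "complex \<Rightarrow> 's"
  assume fg: "hardy_rel f g"
  then have "fourier_coeff f 0 = fourier_coeff g 0"
    by (auto simp: hardy_rel_def hardy_fun_def intro: fourier_coeff_cong_AE)
  with fg show "hardy_rel (\<lambda>z. inverse z *\<^sub>C (f z - fourier_coeff f 0))
      (\<lambda>z. inverse z *\<^sub>C (g z - fourier_coeff g 0))"
    using hardy_fun_backshift[of f] hardy_fun_backshift[of g]
    by (auto simp: hardy_rel_def elim!: eventually_mono)
qed

lemma fourier_coeff_shift:
  "square_integrable f \<Longrightarrow> fourier_coeff (\<lambda>z. z *\<^sub>C f z) n = fourier_coeff f (n - 1)"
  using fourier_coeff_mult_powi[of f 1 n] by simp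

lemma coeff0_const [simp]: "hardy_coeff0 (hardy_const v) = v"
  by transfer (simp add: fourier_coeff_const)

lemma coeff0_shift [simp]: "hardy_coeff0 (shift f) = 0"
  by transfer (auto simp: hardy_rel_def hardy_fun_def fourier_coeff_shift)

lemma shift_backshift: "shift (backshift f) = f - hardy_const (hardy_coeff0 f)"
proof transfer
  fix f :: "complex \<Rightarrow> 'a" assume "hardy_rel f f"
  then have f: "hardy_fun f" by (simp add: hardy_rel_def)
  have "AE z in circle_measure. z *\<^sub>C inverse z *\<^sub>C (f z - fourier_coeff f 0) = f z - fourier_coeff f 0"
    using AE_circle_norm by eventually_elim (auto simp: scaleC_scaleC field_simps)
  then show "hardy_rel (\<lambda>z. z *\<^sub>C inverse z *\<^sub>C (f z - fourier_coeff f 0)) (\<lambda>z. f z - fourier_coeff f 0)"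
    using f by (auto simp: hardy_rel_def hardy_fun_mult_z hardy_fun_backshift hardy_fun_diff hardy_fun_const
       )
qed

lemma backshift_shift [simp]: "backshift (shift f) = f"
proof transfer
  fix f :: "complex \<Rightarrow> 'a" assume "hardy_rel f f"
  then have f: "hardy_fun f" by (simp add: hardy_rel_def)
  then have 0: "fourier_coeff (\<lambda>z. z *\<^sub>C f z) 0 = 0"
    by (simp add: hardy_fun_def fourier_coeff_shift)
  have "AE z in circle_measure. inverse z *\<^sub>C (z *\<^sub>C f z - 0) = f z"
    using AE_circle_norm by eventually_elim (auto simp: scaleC_scaleC field_simps)
  then show "hardy_rel (\<lambda>z. inverse z *\<^sub>C (z *\<^sub>C f z - fourier_coeff (\<lambda>z. z *\<^sub>C f z) 0)) f"
    using f hardy_fun_backshift[OF hardy_fun_mult_z[OF f]] unfolding 0 by (simp add: hardy_rel_def)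
qed

lemma shift_add [simp]: "shift (f + g) = shift f + shift g"
  by transfer (auto simp: hardy_rel_def hardy_fun_add hardy_fun_mult_z scaleC_add_right)

lemma cinner_shift_shift: "cinner (shift f) (shift g) = cinner f g"
proof transfer
  fix f g :: "complex \<Rightarrow> 'a" assume "hardy_rel f f" "hardy_rel g g"
  then have fg: "hardy_fun f" "hardy_fun g" by (simp_all add: hardy_rel_def)
  show "(LINT z|circle_measure. cinner (z *\<^sub>C f z) (z *\<^sub>C g z)) = (LINT z|circle_measure. cinner (f z) (g z))"
  proof (rule integral_cong_AE)
    show "(\<lambda>z. cinner (z *\<^sub>C f z) (z *\<^sub>C g z)) \<in> borel_measurable circle_measure"
      using fg by (intro borel_measurable_integrable integrable_cinner hardy_fun_mult_z)
    show "(\<lambda>z. cinner (f z) (g z)) \<in> borel_measurable circle_measure"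
      using fg by (intro borel_measurable_integrable integrable_cinner)
    show "AE z in circle_measure. cinner (z *\<^sub>C f z) (z *\<^sub>C g z) = cinner (f z) (g z)"
      using AE_circle_norm
    proof eventually_elim
      case (elim z)
      then have "cnj z * z = 1" using complex_norm_square[of z] by (simp add: mult.commute)
      then show ?case
        by (simp add: cinner_scaleC_left cinner_scaleC_right mult.assoc[symmetric])
    qed
  qed
qed

text \<open>Pairing with a fixed \<open>v\<close> is bounded linear and passes through the integral.
  Hence \<open>hardy_coeff0\<close> is the adjoint of \<open>hardy_const\<close>.\<close>

lemma cinner_const: "cinner f (hardy_const v) = cinner (hardy_coeff0 f) v"
proof transfer
  fix f :: "complex \<Rightarrow> 'a" and v assume "hardy_rel f f"
  then have "square_integrable f" by (simp add: hardy_rel_def hardy_fun_def)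
  from integrable_fourier[OF this, of 0] have "integrable circle_measure f" by simp
  from integral_bounded_linear[OF bounded_bilinear.bounded_linear_left[OF bounded_bilinear_cinner] this]
  show "(LINT z|circle_measure. cinner (f z) v) = cinner (fourier_coeff f 0) v"
    by (simp add: fourier_coeff_def)
qed

lemma is_cadjoint_shift: "is_cadjoint shift backshift"
  unfolding is_cadjoint_def
proof (intro allI)
  fix f g :: "'a hardy"
  \<comment> \<open>Split \<open>g\<close> into a shifted part and a constant. Constants are
    orthogonal to the range of the shift, and on the shifted part the shift is isometric.\<close>
  have "cinner (shift f) g = cinner (shift f) (shift (backshift g) + hardy_const (hardy_coeff0 g))"
    by (simp add: shift_backshift)
  also have "\<dots> = cinner f (backshift g)"
    by (simp only: cinner_add_right cinner_shift_shift cinner_const coeff0_shift)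
      (simp add: bounded_bilinear.zero_left[OF bounded_bilinear_cinner])
  finally show "cinner (shift f) g = cinner f (backshift g)" .
qed

section \<open>Operators acting on the coefficients\<close>

text \<open>\<open>I_tensor\<close> is defined through a chosen representative, and is independent
  of that choice for \<open>bounded_clinear\<close> operators. Identities about it are therefore
  checked on representatives.\<close>

lemma hardy_exhaust:
  obtains F where "f = abs_hardy F" "hardy_fun F"
  using abs_rep_hardy hardy_fun_rep by metis

lemma hardy_rel_refl: "hardy_fun f \<Longrightarrow> hardy_rel f f"
  by (simp add: hardy_rel_def)

text \<open>Reduces the whole calculus to \<open>I_tensor\<close> and one \<open>shift\<close> that
  commutes with it.\<close>

lemma S_z_tensor_eq:
  assumes "bounded_clinear A"
  shows "S_z_tensor A f = shift (I_tensor A f)"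
  by (rule hardy_exhaust[of f])
    (simp add: assms S_z_tensor_abs I_tensor_abs shift.abs_eq hardy_rel_refl hardy_fun_bounded_clinear)

lemma I_tensor_add:
  assumes "bounded_clinear A"
  shows "I_tensor A (f + g) = I_tensor A f + I_tensor A g"
  by (rule hardy_exhaust[of f], rule hardy_exhaust[of g])
    (use assms in \<open>simp add: I_tensor_abs plus_hardy.abs_eq hardy_rel_refl hardy_fun_bounded_clinear
      hardy_fun_add bounded_clinear_def linear_simps\<close>)

lemma I_tensor_diff:
  assumes "bounded_clinear A"
  shows "I_tensor A (f - g) = I_tensor A f - I_tensor A g"
  using I_tensor_add[OF assms, of "f - g" g] by simp

lemma bounded_clinear_comp:
  assumes "bounded_clinear A" "bounded_clinear B"
  shows "bounded_clinear (A \<circ> B)"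
  using assms by (auto simp: bounded_clinear_def o_def intro: bounded_linear_compose)

lemma I_tensor_comp:
  assumes "bounded_clinear A" "bounded_clinear B"
  shows "I_tensor (A \<circ> B) f = I_tensor A (I_tensor B f)"
proof (rule hardy_exhaust[of f])
  fix F assume F: "f = abs_hardy F" "hardy_fun F"
  show ?thesis
    using assms bounded_clinear_comp[OF assms] F by (simp add: I_tensor_abs hardy_fun_bounded_clinear)
qed

lemma compl_proj_apply: "compl_proj P x = x - P x"
  by (simp add: compl_proj_def)

lemma bounded_clinear_compl_proj: "bounded_clinear A \<Longrightarrow> bounded_clinear (compl_proj A)"
  by (auto simp: bounded_clinear_def compl_proj_def bounded_linear_sub
      bounded_bilinear.diff_right[OF bounded_bilinear_scaleC])

lemma I_tensor_compl_proj:
  assumes "bounded_clinear A"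
  shows "I_tensor (compl_proj A) f = f - I_tensor A f"
proof (rule hardy_exhaust[of f])
  fix F assume F: "f = abs_hardy F" "hardy_fun F"
  show ?thesis
    using assms bounded_clinear_compl_proj[OF assms] F
    by (simp add: I_tensor_abs minus_hardy.abs_eq hardy_rel_refl hardy_fun_bounded_clinear)
      (simp add: compl_proj_def)
qed

lemma I_tensor_shift:
  assumes "bounded_clinear A"
  shows "I_tensor A (shift f) = shift (I_tensor A f)"
  by (rule hardy_exhaust[of f])
    (use assms in \<open>simp add: I_tensor_abs shift.abs_eq hardy_rel_refl hardy_fun_bounded_clinear
      hardy_fun_mult_z\<close>, simp add: bounded_clinear_def)

lemma I_tensor_const:
  assumes "bounded_clinear A"
  shows "I_tensor A (hardy_const v) = hardy_const (A v)"
  using assms by (simp add: hardy_const.abs_eq I_tensor_abs hardy_fun_const)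

lemma coeff0_I_tensor:
  assumes "bounded_clinear A"
  shows "hardy_coeff0 (I_tensor A f) = A (hardy_coeff0 f)"
proof (rule hardy_exhaust[of f])
  fix F assume F: "f = abs_hardy F" "hardy_fun F"
  then have "square_integrable F" by (simp add: hardy_fun_def)
  then show ?thesis
    using assms F by (simp add: I_tensor_abs hardy_coeff0.abs_eq hardy_rel_refl
      hardy_fun_bounded_clinear fourier_coeff_bounded_clinear)
qed

lemma coeff0_add: "hardy_coeff0 (f + g) = hardy_coeff0 f + hardy_coeff0 g"
  by transfer (simp add: hardy_rel_def hardy_fun_def fourier_coeff_add)

lemma is_cadjoint_I_tensor:
  assumes "bounded_clinear A" "bounded_clinear A'" "is_cadjoint A A'"
  shows "is_cadjoint (I_tensor A) (I_tensor A')"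
  unfolding is_cadjoint_def
proof (intro allI)
  fix f g :: "'a hardy"
  show "cinner (I_tensor A f) g = cinner f (I_tensor A' g)"
    by (rule hardy_exhaust[of f], rule hardy_exhaust[of g])
      (use assms in \<open>simp add: I_tensor_abs cinner_hardy.abs_eq hardy_rel_refl
        hardy_fun_bounded_clinear\<close>, simp add: is_cadjoint_def)
qed

section \<open>Calculus of adjoint pairs\<close>

lemma is_cadjoint_comp:
  assumes "is_cadjoint S S'" "is_cadjoint T T'"
  shows "is_cadjoint (\<lambda>x. S (T x)) (\<lambda>x. T' (S' x))"
  using assms by (simp add: is_cadjoint_def)

lemma is_cadjoint_add:
  assumes "is_cadjoint S S'" "is_cadjoint T T'"
  shows "is_cadjoint (\<lambda>x. S x + T x) (\<lambda>x. S' x + T' x)"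
  using assms by (simp add: is_cadjoint_def cinner_add_left cinner_add_right)

lemma is_cadjoint_sym: "is_cadjoint T T' \<Longrightarrow> is_cadjoint T' T"
  unfolding is_cadjoint_def by (metis cinner_commute)

lemma is_cadjoint_compl_proj: "is_cadjoint A A' \<Longrightarrow> is_cadjoint (compl_proj A) (compl_proj A')"
  by (simp add: is_cadjoint_def compl_proj_def
      bounded_bilinear.diff_left[OF bounded_bilinear_cinner]
      bounded_bilinear.diff_right[OF bounded_bilinear_cinner])

text \<open>Pairing the additivity defect of \<open>T\<close> with any vector gives 0 once
  \<open>T\<close> is moved across as \<open>T'\<close>; pairing it with itself shows that it
  vanishes. This yields additivity of \<open>backshift\<close> and of the inverse of a
  unitary.\<close>

lemma is_cadjoint_imp_add:
  assumes "is_cadjoint T T'"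
  shows "T (x + y) = T x + T y"
proof -
  have eq: "cinner z (T w) = cinner (T' z) w" for z w
    using is_cadjoint_sym[OF assms] by (simp add: is_cadjoint_def)
  have "cinner z (T (x + y) - (T x + T y)) = 0" for z
    by (simp add: eq cinner_add_right bounded_bilinear.diff_right[OF bounded_bilinear_cinner])
  from this[of "T (x + y) - (T x + T y)"] have "norm (T (x + y) - (T x + T y)) = 0"
    by (simp only: cinner_self) simp
  then show ?thesis by simp
qed

lemma is_cadjoint_eq_0_iff:
  assumes "is_cadjoint T T'"
  shows "(\<forall>x. T' x = 0) \<longleftrightarrow> (\<forall>x. T x = 0)"
proof -
  have imp: "\<forall>x. S x = 0" if "\<forall>x. S' x = 0" "is_cadjoint S S'"
    for S :: "'c::complex_inner \<Rightarrow> 'd::complex_inner" and S'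
  proof
    fix x
    have "cinner (S x) (S x) = 0"
      using that by (simp add: is_cadjoint_def bounded_bilinear.zero_right[OF bounded_bilinear_cinner])
    then show "S x = 0" by (simp add: cinner_self)
  qed
  show ?thesis
    using imp[OF _ assms] imp[OF _ is_cadjoint_sym[OF assms]] by blast
qed

lemma backshift_add: "backshift (f + g) = backshift f + backshift g"
  by (rule is_cadjoint_imp_add[OF is_cadjoint_sym[OF is_cadjoint_shift]])

lemma additive_zero_diff:
  fixes T :: "'a::ab_group_add \<Rightarrow> 'b::ab_group_add"
  assumes "\<And>x y. T (x + y) = T x + T y"
  shows "T 0 = 0" "T (x - y) = T x - T y"
  using assms[of 0 0] assms[of "x - y" y] by simp_all

lemma hardy_const_add: "hardy_const (v + w) = hardy_const v + hardy_const w"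
  by transfer (simp add: hardy_rel_def hardy_fun_const)

lemmas const_zero = additive_zero_diff(1)[OF hardy_const_add]
  and const_diff = additive_zero_diff(2)[OF hardy_const_add]
  and coeff0_zero = additive_zero_diff(1)[OF coeff0_add]
  and shift_zero = additive_zero_diff(1)[OF shift_add]
  and shift_diff = additive_zero_diff(2)[OF shift_add]
  and backshift_zero = additive_zero_diff(1)[OF backshift_add]
  and backshift_diff = additive_zero_diff(2)[OF backshift_add]

text \<open>\<open>shift\<close> sends the left-hand side to 0, and \<open>shift\<close> has the
  left inverse \<open>backshift\<close>.\<close>

lemma backshift_const: "backshift (hardy_const v) = 0"
  using shift_backshift[of "hardy_const v"] backshift_shift[of "backshift (hardy_const v)"]
  by (simp add: backshift_zero)

text \<open>Both sides agree after applying the injective \<open>shift\<close>, because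
  \<open>I_tensor A\<close> commutes with \<open>shift\<close> and with removal of the constant
  term.\<close>

lemma I_tensor_backshift:
  assumes "bounded_clinear A"
  shows "backshift (I_tensor A f) = I_tensor A (backshift f)"
proof -
  have "shift (backshift (I_tensor A f)) = shift (I_tensor A (backshift f))"
    using assms
    by (simp add: shift_backshift I_tensor_shift[symmetric] I_tensor_diff I_tensor_const coeff0_I_tensor)
  then show ?thesis by (metis backshift_shift)
qed

section \<open>The BCL pair\<close>

lemma unitary_op_cadjoint:
  assumes "unitary_op U"
  shows "is_cadjoint U (cadjoint U)" "U (cadjoint U x) = x" "cadjoint U (U x) = x"
    "bounded_clinear (cadjoint U)"
proof -
  have bl: "bounded_linear U" and sc: "U (c *\<^sub>C x) = c *\<^sub>C U x" and "surj U"
    and iso: "cinner (U x) (U y) = cinner x y" for c x y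
    using assms by (auto simp: unitary_op_def bounded_clinear_def)
  then have r: "U (inv U x) = x" for x
    by (simp add: surj_f_inv_f)
  \<comment> \<open>Write \<open>y = U (inv U y)\<close> and use that \<open>U\<close> preserves the
    inner product. This exhibits an adjoint, so the description in \<open>cadjoint\<close> is
    meaningful.\<close>
  have adj: "is_cadjoint U (inv U)"
    unfolding is_cadjoint_def using iso[of _ "inv U _"] by (simp add: r)
  then have eq: "cadjoint U = inv U"
    by (rule cadjoint_eq)
  have nrm: "norm (U x) = norm x" for x
    using iso[of x x] by (simp only: cinner_self of_real_eq_iff) simp
  have "inj U"
  proof (rule injI)
    fix x y assume "U x = U y"
    then have "norm (U (x - y)) = 0" using bl by (simp add: linear_simps)
    then show "x = y" by (simp add: nrm)
  qed
  then have l: "inv U (U x) = x" for x by simp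
  have sc': "inv U (c *\<^sub>C x) = c *\<^sub>C inv U x" for c x
    using l[of "c *\<^sub>C inv U x"] by (simp add: sc r)
  have "bounded_linear (inv U)"
  proof (rule bounded_linear_intro[where K = 1])
    show "inv U (x + y) = inv U x + inv U y" for x y
      by (rule is_cadjoint_imp_add[OF is_cadjoint_sym[OF adj]])
    show "inv U (r *\<^sub>R x) = r *\<^sub>R inv U x" for r x
      using sc'[of "of_real r" x] by (simp add: scaleC_of_real)
    show "norm (inv U x) \<le> norm x * 1" for x
      using nrm[of "inv U x"] by (simp add: r)
  qed
  with sc' have "bounded_clinear (inv U)"
    by (simp add: bounded_clinear_def)
  with adj r l show "is_cadjoint U (cadjoint U)" "U (cadjoint U x) = x" "cadjoint U (U x) = x"
    "bounded_clinear (cadjoint U)"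
    unfolding eq by auto
qed

lemma orth_projection_idem: "orth_projection P \<Longrightarrow> P (P x) = P x"
  by (auto simp: orth_projection_def fun_eq_iff)

locale bcl =
  fixes U P :: "'s::{complex_hilbert, second_countable_topology} \<Rightarrow> 's"
  assumes bcl: "bcl_triple U P"
begin

lemma unitary: "unitary_op U" and projection: "orth_projection P"
  using bcl by (auto simp: bcl_triple_def)

lemmas UU' [simp] = unitary_op_cadjoint(2)[OF unitary]
lemmas U'U [simp] = unitary_op_cadjoint(3)[OF unitary]
lemmas PP [simp] = orth_projection_idem[OF projection]

lemma bounded_clinear [simp]:
  "bounded_clinear U" "bounded_clinear P" "bounded_clinear (cadjoint U)"
  "bounded_clinear (compl_proj P)"
  using unitary projection unitary_op_cadjoint(4)[OF unitary]
  by (auto simp: unitary_op_def orth_projection_def bounded_clinear_compl_proj)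

lemma diff [simp]: "U (x - y) = U x - U y" "P (x - y) = P x - P y"
    "cadjoint U (x - y) = cadjoint U x - cadjoint U y"
  and add [simp]: "U (x + y) = U x + U y" "P (x + y) = P x + P y"
    "cadjoint U (x + y) = cadjoint U x + cadjoint U y"
  and zero [simp]: "U 0 = 0" "P 0 = 0" "cadjoint U 0 = 0"
  using bounded_clinear unfolding bounded_clinear_def by (simp_all add: linear_simps)

lemma I_tensor_cancel [simp]:
  "I_tensor U (I_tensor (cadjoint U) f) = f" "I_tensor (cadjoint U) (I_tensor U f) = f"
  "I_tensor P (I_tensor P f) = I_tensor P f"
  by (rule hardy_exhaust[of f], simp add: I_tensor_abs hardy_fun_bounded_clinear)+

section \<open>The BCL operators, their adjoints and products\<close>

lemma M_phi1_eq: "M_phi1 U P = (\<lambda>f. I_tensor P (I_tensor (cadjoint U) f)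
    + shift (I_tensor (compl_proj P) (I_tensor (cadjoint U) f)))"
  by (simp add: M_phi1_def I_tensor_comp S_z_tensor_eq bounded_clinear_comp)

lemma M_phi2_eq: "M_phi2 U P = (\<lambda>f. I_tensor U (I_tensor (compl_proj P) f)
    + shift (I_tensor U (I_tensor P f)))"
  by (simp add: M_phi2_def I_tensor_comp S_z_tensor_eq bounded_clinear_comp)

lemma cadjoint_P: "is_cadjoint P P"
  using projection by (simp add: orth_projection_def)

lemmas is_cadjoint_I_tensor_P = is_cadjoint_I_tensor[OF _ _ cadjoint_P, simplified]
lemmas is_cadjoint_I_tensor_compl_P =
  is_cadjoint_I_tensor[OF _ _ is_cadjoint_compl_proj[OF cadjoint_P], simplified]
lemmas is_cadjoint_I_tensor_U =
  is_cadjoint_I_tensor[OF _ _ unitary_op_cadjoint(1)[OF unitary], simplified]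

lemma cadjoint_M_phi1: "cadjoint (M_phi1 U P) = (\<lambda>f. I_tensor U (I_tensor P f)
    + I_tensor U (I_tensor (compl_proj P) (backshift f)))"
  unfolding M_phi1_eq
  using cadjoint_eq[OF is_cadjoint_add[OF
      is_cadjoint_comp[OF is_cadjoint_I_tensor_P is_cadjoint_sym[OF is_cadjoint_I_tensor_U]]
      is_cadjoint_comp[OF is_cadjoint_shift is_cadjoint_comp[OF
        is_cadjoint_I_tensor_compl_P is_cadjoint_sym[OF is_cadjoint_I_tensor_U]]]]] .

lemma cadjoint_M_phi2: "cadjoint (M_phi2 U P) =
    (\<lambda>f. I_tensor (compl_proj P) (I_tensor (cadjoint U) f)
      + I_tensor P (I_tensor (cadjoint U) (backshift f)))"
  unfolding M_phi2_eq
  using cadjoint_eq[OF is_cadjoint_add[OF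
      is_cadjoint_comp[OF is_cadjoint_I_tensor_U is_cadjoint_I_tensor_compl_P]
      is_cadjoint_comp[OF is_cadjoint_shift is_cadjoint_comp[OF
        is_cadjoint_I_tensor_U is_cadjoint_I_tensor_P]]]] .

text \<open>A normal form: \<open>shift\<close> and \<open>backshift\<close> move outward past
  \<open>I_tensor\<close> until they meet. Then \<open>backshift_shift\<close> cancels them in one
  order, and \<open>shift_backshift\<close> leaves a constant correction in the other.\<close>

lemmas tensor_simps = I_tensor_add I_tensor_diff I_tensor_compl_proj I_tensor_shift I_tensor_const
  I_tensor_backshift[symmetric] backshift_add backshift_diff shift_diff shift_backshift
  shift_zero backshift_zero
  coeff0_I_tensor coeff0_add

text \<open>With \<open>V\<^sub>1 = (P + S P\<^sup>\<bottom>) U\<^sup>*\<close> the unitary cancels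
  and the mixed terms contain \<open>P P\<^sup>\<bottom> = 0\<close>. What is left is
  \<open>P + S S\<^sup>* P\<^sup>\<bottom>\<close>, where \<open>S S\<^sup>* = I - K c\<close>. The
  computation for \<open>V\<^sub>2 = U (P\<^sup>\<bottom> + S P)\<close> is parallel.\<close>

lemma M_phi1_cadjoint:
  "M_phi1 U P (cadjoint (M_phi1 U P) f) = f - hardy_const (compl_proj P (hardy_coeff0 f))"
  unfolding M_phi1_eq[THEN fun_cong] cadjoint_M_phi1
  by (simp add: tensor_simps compl_proj_apply const_diff)

lemma M_phi2_cadjoint:
  "M_phi2 U P (cadjoint (M_phi2 U P) f) = f - hardy_const (U (P (cadjoint U (hardy_coeff0 f))))"
  unfolding M_phi2_eq[THEN fun_cong] cadjoint_M_phi2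
  by (simp add: tensor_simps)

lemma M_phi1_M_phi2: "M_phi1 U P (M_phi2 U P f) = shift f"
  unfolding M_phi1_eq M_phi2_eq by (simp add: tensor_simps)

lemma cadjoint_M_phi1_M_phi2:
  "cadjoint (M_phi1 U P) (cadjoint (M_phi2 U P) f) = backshift f"
  unfolding cadjoint_M_phi1 cadjoint_M_phi2 by (simp add: tensor_simps)

section \<open>The operator \<open>H_op\<close> of the BCL pair and its vanishing\<close>

lemma M_phi2_diff: "M_phi2 U P (f - g) = M_phi2 U P f - M_phi2 U P g"
  unfolding M_phi2_eq by (simp add: tensor_simps)

lemma M_phi2_const:
  "M_phi2 U P (hardy_const v) = hardy_const (U (compl_proj P v)) + shift (hardy_const (U (P v)))"
  unfolding M_phi2_eq by (simp add: tensor_simps compl_proj_apply const_diff)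

text \<open>Inserting the formula for the inner \<open>V\<^sub>2 V\<^sub>2\<^sup>*\<close> into
  \<open>V\<^sub>2 V\<^sub>2 V\<^sub>2\<^sup>* V\<^sub>2\<^sup>*\<close> gives
  \<open>V\<^sub>2 V\<^sub>2\<^sup>*\<close>, which cancels the first term of \<open>H\<close>,
  minus \<open>V\<^sub>2\<close> applied to the constant \<open>U (P (w f))\<close>. The remaining
  \<open>S S\<^sup>* - V\<^sub>1 V\<^sub>1\<^sup>*\<close> contributes
  \<open>- K P c\<close>.\<close>

lemma H_op_eq:
  defines "w f \<equiv> cadjoint U (hardy_coeff0 (cadjoint (M_phi2 U P) f))"
  shows "H_op (M_phi1 U P) (M_phi2 U P) f =
    hardy_const (U (U (P (w f))) - U (P (U (P (w f)))) - P (hardy_coeff0 f))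
    + shift (hardy_const (U (P (U (P (w f))))))"
  unfolding H_op_def
  by (simp add: M_phi1_cadjoint M_phi2_cadjoint M_phi2_diff M_phi1_M_phi2 cadjoint_M_phi1_M_phi2
      M_phi2_const w_def compl_proj_apply shift_backshift const_diff)

lemma coeff0_cadjoint_M_phi2:
  "hardy_coeff0 (cadjoint (M_phi2 U P) f) =
    cadjoint U (hardy_coeff0 f) - P (cadjoint U (hardy_coeff0 f))
    + P (cadjoint U (hardy_coeff0 (backshift f)))"
  unfolding cadjoint_M_phi2 by (simp add: coeff0_add coeff0_I_tensor compl_proj_apply)

text \<open>The Fourier coefficients of index 0 and 1 recover \<open>v\<close> and \<open>w\<close>;
  index 1 is read off as \<open>hardy_coeff0\<close> after \<open>backshift\<close>.\<close>

lemma const_plus_shift_eq_0_iff: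
  "hardy_const v + shift (hardy_const w) = 0 \<longleftrightarrow> v = 0 \<and> w = 0"
proof
  assume eq: "hardy_const v + shift (hardy_const w) = 0"
  from arg_cong[OF eq, of hardy_coeff0] have "v = 0"
    by (simp add: coeff0_add coeff0_zero)
  moreover from arg_cong[OF eq, of "\<lambda>f. hardy_coeff0 (backshift f)"] have "w = 0"
    by (simp add: coeff0_add coeff0_zero backshift_add backshift_const backshift_zero)
  ultimately show "v = 0 \<and> w = 0" by simp
qed (simp add: const_zero shift_zero)

text \<open>\<open>P U\<^sup>* P\<close> is the adjoint of \<open>P U P\<close>, and an operator
  vanishes exactly when its adjoint does.\<close>

lemma PU'P_eq_0_iff: "(\<forall>x. P (cadjoint U (P x)) = 0) \<longleftrightarrow> (\<forall>x. P (U (P x)) = 0)"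
proof -
  have "cinner (P (U (P x))) y = cinner x (P (cadjoint U (P y)))" for x y
    using cadjoint_P unitary_op_cadjoint(1)[OF unitary] by (simp add: is_cadjoint_def)
  then have "is_cadjoint (\<lambda>x. P (U (P x))) (\<lambda>x. P (cadjoint U (P x)))"
    by (simp add: is_cadjoint_def)
  from is_cadjoint_eq_0_iff[OF this] show ?thesis by blast
qed

lemma H_op_eq_0_iff:
  "H_op (M_phi1 U P) (M_phi2 U P) = (\<lambda>_. 0) \<longleftrightarrow>
    (\<forall>x. P (U (P x)) = 0) \<and> (\<forall>x. U (U (P (cadjoint U (cadjoint U x)))) = P x)"
proof
  assume "H_op (M_phi1 U P) (M_phi2 U P) = (\<lambda>_. 0)"
  then have H: "H_op (M_phi1 U P) (M_phi2 U P) f = 0" for f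
    by simp
  note coeffs = H[unfolded H_op_eq const_plus_shift_eq_0_iff coeff0_cadjoint_M_phi2]
  have "P (U (P (cadjoint U (P x)))) = 0" for x
  proof -
    have "U (P (U (P (cadjoint U (P x))))) = 0"
      \<comment> \<open>The coefficients of index 0 and 1 of this test function are 0 and
        \<open>U x\<close>, so \<open>V\<^sub>2\<^sup>* f\<close> has constant term
        \<open>P x\<close>. The index 1 part of \<open>H f = 0\<close> is the claim.\<close>
      using coeffs[of "shift (hardy_const (U x))"] by simp
    then have "cadjoint U (U (P (U (P (cadjoint U (P x)))))) = 0"
      by (simp only: zero)
    then show ?thesis by simp
  qed
  \<comment> \<open>With \<open>T = P U P\<close> this reads \<open>\<langle>T\<^sup>* x, T\<^sup>*
    x\<rangle> = \<langle>T T\<^sup>* x, x\<rangle>\<close>, so the vanishing of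
    \<open>T T\<^sup>*\<close> forces \<open>T\<^sup>* = 0\<close>.\<close>
  moreover have "cinner (P (cadjoint U (P x))) (P (cadjoint U (P x)))
      = cinner (P (U (P (cadjoint U (P x))))) x" for x
    using cadjoint_P unitary_op_cadjoint(1)[OF unitary] by (simp add: is_cadjoint_def)
  ultimately have PU'P: "P (cadjoint U (P x)) = 0" for x
    by (simp add: cinner_self bounded_bilinear.zero_left[OF bounded_bilinear_cinner])
  then have PUP: "\<forall>x. P (U (P x)) = 0"
    using PU'P_eq_0_iff by blast
  moreover have "U (U (P (cadjoint U (cadjoint U x)))) = P x" for x
    \<comment> \<open>A constant has zero backward shift, and \<open>P U\<^sup>* P = 0\<close>
      reduces \<open>P w\<close> to \<open>P U\<^sup>* U\<^sup>* x\<close>. The index 0 part is then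
      the claimed equation, since its middle term contains \<open>P U P\<close>.\<close>
    using coeffs[of "hardy_const x"] PUP by (simp add: PU'P backshift_const coeff0_zero)
  ultimately show "(\<forall>x. P (U (P x)) = 0) \<and> (\<forall>x. U (U (P (cadjoint U (cadjoint U x)))) = P x)"
    by blast
next
  assume *: "(\<forall>x. P (U (P x)) = 0) \<and> (\<forall>x. U (U (P (cadjoint U (cadjoint U x)))) = P x)"
  \<comment> \<open>This removes from \<open>P w\<close> the contribution of the index 1 coefficient
    of \<open>f\<close>, so that only \<open>P U\<^sup>* U\<^sup>*\<close> of the constant term
    remains.\<close>
  then have "P (cadjoint U (P x)) = 0" for x
    using PU'P_eq_0_iff by blast
  with * show "H_op (M_phi1 U P) (M_phi2 U P) = (\<lambda>_. 0)"
    by (simp add: fun_eq_iff H_op_eq const_plus_shift_eq_0_iff coeff0_cadjoint_M_phi2)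
qed

end

theorem theorem3p2:
  fixes U P :: "'s::{complex_hilbert, second_countable_topology} \<Rightarrow> 's"
  assumes "bcl_triple U P"
  shows "H_op (M_phi1 U P) (M_phi2 U P) = (\<lambda>_. 0) \<longleftrightarrow>
    P \<circ> U \<circ> P = (\<lambda>_. 0) \<and> U \<circ> U \<circ> P \<circ> cadjoint U \<circ> cadjoint U = P"
proof -
  interpret bcl U P by unfold_locales (fact assms)
  show ?thesis
    unfolding H_op_eq_0_iff by (auto simp: fun_eq_iff)
qed

end
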